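(* The only solutions of the Diophantine equation $F_n - F_m = 13^a$ in non-negative integers $(n,m,a)$ with $n \geqslant 2$ and $m < n$ are $$(n,m,a) \in \{(2,0,0),(3,1,0),(3,2,0),(4,3,0),(7,0,1),(8,6,1),(9,8,1)\},$$ namely $F_2 - F_0 = F_3 - F_1 = F_3 - F_2 = F_4 - F_3 = 13^0$ and $F_7 - F_0 = F_8 - F_6 = F_9 - F_8 = 13^1$.
   Context: $(F_n)_{n\geqslant 0}$ denotes the Fibonacci sequence: $F_0=0$, $F_1=1$, and $F_n=F_{n-1}+F_{n-2}$ for $n\geqslant 2$. *)

theory Defs
  imports "HOL-Number_Theory.Fib"
begin

end

(* If a <= 1, then F_(n-2) <= F_n - F_m <= 13 forces n <= 9.  If a >= 2, write a = b + 2; then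
   F_n = F_m + 169 * 13^b has no solution even modulo 13^2 * 29 * 71 * 131 * 911.
   The incongruence is found by a sieve: the moduli are taken one at a time, and only the residue
   classes of (n, m, b) compatible with all previous moduli are lifted and tested modulo the next
   one.  The Fibonacci periods and the multiplicative orders of 13 for these moduli all divide 1820,
   and in the chosen order at most 96 classes ever survive. *)

theory Submission
  imports Defs "HOL-Number_Theory.Cong" "HOL-Library.Code_Binary_Nat" "HOL-Library.Tree"
begin

section \<open>Periodicity of Fibonacci numbers and powers modulo p\<close>

lemma mod_mult_decompose:
  fixes n P Q :: nat
  assumes "P dvd Q" "0 < Q"
  shows "\<exists>u < Q div P. n mod Q = P * u + n mod P"
proof -
  obtain r where r: "Q = P * r" using assms(1) ..
  with assms(2) have "0 < r" "0 < P" by auto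
  with r show ?thesis
    by (intro exI[of _ "n div P mod r"]) (simp add: mod_mult2_eq)
qed

text \<open>The shifted sequence obeys the same recurrence, and the hypotheses match its first two
  values.\<close>

lemma fib_cong_add_period:
  assumes "[fib k = 0] (mod p)" "[fib (Suc k) = 1] (mod p)"
  shows "[fib (n + k) = fib n] (mod p)"
proof (induction n rule: fib.induct)
  case (3 n)
  then show ?case by (simp add: cong_add)
qed (use assms in simp_all)

lemma fib_cong_mod_period:
  assumes "[fib k = 0] (mod p)" "[fib (Suc k) = 1] (mod p)"
  shows "[fib n = fib (n mod k)] (mod p)"
proof -
  have "[fib (i + k * t) = fib i] (mod p)" for i t
  proof (induction t)
    case (Suc t)
    then show ?case
      using cong_trans[OF fib_cong_add_period[OF assms, of "i + k * t"]]
      by (simp add: algebra_simps)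
  qed simp
  from this[of "n mod k" "n div k"] show ?thesis by simp
qed

text \<open>Keeping the factor \<open>c\<close> in the hypothesis, instead of asking for
  \<open>q ^ l\<close> to be 1, admits moduli that share a factor with \<open>q\<close>, such as 13
  and 169 for \<open>q = 13\<close>.\<close>

lemma power_cong_mod_period:
  fixes c q :: nat
  assumes "[c * q ^ l = c] (mod p)"
  shows "[c * q ^ n = c * q ^ (n mod l)] (mod p)"
proof -
  have "[c * q ^ (i + l * t) = c * q ^ i] (mod p)" for i t
  proof (induction t)
    case (Suc t)
    have "[c * q ^ l * q ^ (i + l * t) = c * q ^ (i + l * t)] (mod p)"
      using assms by (rule cong_scalar_right)
    from cong_trans[OF this Suc] show ?case
      by (simp add: power_add algebra_simps)
  qed simp
  from this[of "n mod l" "n div l"] show ?thesis by simp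
qed

section \<open>Residue tables\<close>

primrec fib_residues :: "nat \<Rightarrow> nat \<Rightarrow> nat \<Rightarrow> nat \<Rightarrow> nat list" where
  "fib_residues 0 p x y = []"
| "fib_residues (Suc k) p x y = x # fib_residues k p y ((x + y) mod p)"

lemma nth_fib_residues:
  "i < k \<Longrightarrow> fib_residues k p (fib n mod p) (fib (Suc n) mod p) ! i = fib (n + i) mod p"
proof (induction k arbitrary: i n)
  case (Suc k)
  show ?case
  proof (cases i)
    case (Suc j)
    have "(fib n mod p + fib (Suc n) mod p) mod p = fib (Suc (Suc n)) mod p"
      by (simp add: mod_simps add.commute)
    with Suc Suc.IH[of j "Suc n"] Suc.prems show ?thesis by simp
  qed simp
qed simp

primrec geometric_residues :: "nat \<Rightarrow> nat \<Rightarrow> nat \<Rightarrow> nat \<Rightarrow> nat list" where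
  "geometric_residues 0 p q x = []"
| "geometric_residues (Suc k) p q x = x # geometric_residues k p q (x * q mod p)"

lemma nth_geometric_residues:
  "i < k \<Longrightarrow> geometric_residues k p q (c mod p) ! i = c * q ^ i mod p"
proof (induction k arbitrary: i c)
  case (Suc k)
  show ?case
  proof (cases i)
    case (Suc j)
    with Suc.IH[of j "c * q"] Suc.prems show ?thesis
      by (simp add: mod_simps mult.assoc)
  qed simp
qed simp

text \<open>Residue tables are stored as Braun trees, because the simplifier evaluates \<open>(!)\<close> on a long list
  of numerals in quadratic time. The path to an entry is given by the binary digits of its position.\<close>

fun push_front :: "'a \<Rightarrow> 'a tree \<Rightarrow> 'a tree" where
  "push_front x \<langle>\<rangle> = \<langle>\<langle>\<rangle>, x, \<langle>\<rangle>\<rangle>"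
| "push_front x \<langle>l, y, r\<rangle> = \<langle>push_front y r, x, l\<rangle>"

fun entry :: "nat tree \<Rightarrow> num \<Rightarrow> nat" where
  "entry \<langle>\<rangle> n = 0"
| "entry \<langle>l, x, r\<rangle> num.One = x"
| "entry \<langle>l, x, r\<rangle> (num.Bit0 n) = entry l n"
| "entry \<langle>l, x, r\<rangle> (num.Bit1 n) = entry r n"

definition braun :: "'a list \<Rightarrow> 'a tree" where
  "braun xs = foldr push_front xs \<langle>\<rangle>"

text \<open>The shift by 1 is there because \<open>num\<close> starts at \<open>One\<close>, the
  position of the root.\<close>

definition lookup :: "nat tree \<Rightarrow> nat \<Rightarrow> nat" where
  "lookup t i = entry t (num_of_nat (i + 1))"

lemma entry_push_front_One: "entry (push_front x t) num.One = x"
  by (cases t) simp_all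

text \<open>Position 2n moves to 2n + 1, so the left subtree becomes the right one; 2n + 1 moves to
  2n + 2, so the right subtree, with the old root in front, becomes the left one.\<close>

lemma entry_push_front_inc: "entry (push_front x t) (Num.inc n) = entry t n"
proof (induction x t arbitrary: n rule: push_front.induct)
  case (1 x)
  show ?case by (cases n) simp_all
next
  case (2 x l y r)
  then show ?case by (cases n) (simp_all add: entry_push_front_One)
qed

lemma lookup_braun: "i < length xs \<Longrightarrow> lookup (braun xs) i = xs ! i"
proof (induction xs arbitrary: i)
  case (Cons x xs)
  then show ?case
    by (cases i) (simp_all add: lookup_def braun_def entry_push_front_One entry_push_front_inc)
qed simp

definition fib_table :: "nat \<Rightarrow> nat \<Rightarrow> nat tree" where
  "fib_table k p = braun (fib_residues k p 0 (1 mod p))"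

definition geometric_table :: "nat \<Rightarrow> nat \<Rightarrow> nat \<Rightarrow> nat \<Rightarrow> nat tree" where
  "geometric_table k p q c = braun (geometric_residues k p q (c mod p))"

lemma length_fib_residues: "length (fib_residues k p x y) = k"
  by (induction k arbitrary: x y) simp_all

lemma length_geometric_residues: "length (geometric_residues k p q x) = k"
  by (induction k arbitrary: x) simp_all

lemma lookup_fib_table: "i < k \<Longrightarrow> lookup (fib_table k p) i = fib i mod p"
  using nth_fib_residues[of i k p 0]
  by (simp add: fib_table_def lookup_braun length_fib_residues)

lemma lookup_geometric_table: "i < k \<Longrightarrow> lookup (geometric_table k p q c) i = c * q ^ i mod p"
  by (simp add: geometric_table_def lookup_braun length_geometric_residues nth_geometric_residues)

section \<open>The sieve on residue classes\<close>

text \<open>Each lift carries its tabulated residue, so the search over triples does no further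
  lookups.\<close>

definition lifts :: "nat tree \<Rightarrow> nat \<Rightarrow> nat \<Rightarrow> nat \<Rightarrow> nat \<Rightarrow> (nat \<times> nat) list" where
  "lifts t k P r i = map (\<lambda>u. (P * u + i, lookup t ((P * u + i) mod k))) [0..<r]"

lemma lifts_mod:
  assumes "P dvd Q" "k dvd Q" "0 < Q"
  shows "(n mod Q, lookup t (n mod k)) \<in> set (lifts t k P (Q div P) (n mod P))"
proof -
  obtain u where u: "u < Q div P" "n mod Q = P * u + n mod P"
    using mod_mult_decompose[OF assms(1,3)] by blast
  then have "(P * u + n mod P) mod k = n mod k"
    using assms(2) by (metis mod_mod_cancel)
  with u show ?thesis
    by (auto simp: lifts_def intro!: image_eqI[of _ _ u])
qed

definition solutions_mod ::
    "nat \<Rightarrow> (nat \<times> nat) list \<Rightarrow> (nat \<times> nat) list \<Rightarrow> (nat \<times> nat) list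
      \<Rightarrow> (nat \<times> nat \<times> nat) list" where
  "solutions_mod p xs ys zs =
     concat (map (\<lambda>(z, h). concat (map (\<lambda>(y, g).
       map (\<lambda>(x, f). (x, y, z)) (filter (\<lambda>(x, f). f = (g + h) mod p) xs)) ys)) zs)"

lemma solutions_modI:
  assumes "(x, f) \<in> set xs" "(y, g) \<in> set ys" "(z, h) \<in> set zs" "f = (g + h) mod p"
  shows "(x, y, z) \<in> set (solutions_mod p xs ys zs)"
  unfolding solutions_mod_def set_concat set_map UN_simps bex_UN UN_iff image_image case_prod_beta
  by (intro bexI[OF _ assms(3)] bexI[OF _ assms(2)]) (use assms(1,4) in force)

definition refine_classes ::
    "nat \<Rightarrow> nat \<Rightarrow> nat \<Rightarrow> nat \<Rightarrow> nat \<Rightarrow> nat \<Rightarrow> nat \<Rightarrow> nat tree \<Rightarrow> nat tree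
      \<Rightarrow> (nat \<times> nat \<times> nat) list \<Rightarrow> (nat \<times> nat \<times> nat) list" where
  "refine_classes p k l P r Q s ft gt S =
     concat (map (\<lambda>(i, j, c). solutions_mod p (lifts ft k P r i) (lifts ft k P r j)
       (lifts gt l Q s c)) S)"

text \<open>In a state \<open>(P, Q, S)\<close>, the triples in \<open>S\<close> are classes of n
  and m modulo \<open>P\<close> and of b modulo \<open>Q\<close>.\<close>

fun sieve_step ::
    "nat \<Rightarrow> nat \<Rightarrow> nat \<times> nat \<times> nat \<Rightarrow> nat \<times> nat \<times> (nat \<times> nat \<times> nat) list
      \<Rightarrow> nat \<times> nat \<times> (nat \<times> nat \<times> nat) list" where
  "sieve_step c q (p, k, l) (P, Q, S) =
     (lcm P k, lcm Q l,
      refine_classes p k l P (lcm P k div P) Q (lcm Q l div Q)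
        (fib_table k p) (geometric_table l p q c) S)"

fun are_periods :: "nat \<Rightarrow> nat \<Rightarrow> nat \<times> nat \<times> nat \<Rightarrow> bool" where
  "are_periods c q (p, k, l) \<longleftrightarrow> 0 < k \<and> 0 < l \<and>
     lookup (fib_table (k + 2) p) k = 0 \<and> lookup (fib_table (k + 2) p) (k + 1) = 1 mod p \<and>
     lookup (geometric_table (l + 1) p q c) l = c mod p"

lemma are_periodsD:
  assumes "are_periods c q (p, k, l)"
  shows "0 < k" "0 < l" "[fib k = 0] (mod p)" "[fib (Suc k) = 1] (mod p)"
    "[c * q ^ l = c] (mod p)"
  using assms by (simp_all add: lookup_fib_table lookup_geometric_table cong_def)

definition survives ::
    "nat \<Rightarrow> nat \<Rightarrow> nat \<Rightarrow> nat \<times> nat \<times> (nat \<times> nat \<times> nat) list \<Rightarrow> bool" where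
  "survives n m b = (\<lambda>(P, Q, S). 0 < P \<and> 0 < Q \<and> (n mod P, m mod P, b mod Q) \<in> set S)"

text \<open>Modulo \<open>p\<close> the three terms depend only on n and m modulo \<open>k\<close>
  and on b modulo \<open>l\<close>, hence on the classes modulo the two lcms. The true classes lift
  surviving ones and satisfy the equation modulo \<open>p\<close>, so they pass the filter.\<close>

lemma survives_sieve_step:
  assumes eq: "fib n = fib m + c * q ^ b"
    and per: "are_periods c q st"
    and surv: "survives n m b X"
  shows "survives n m b (sieve_step c q st X)"
proof -
  obtain p k l where st: "st = (p, k, l)" by (cases st)
  obtain P Q S where X: "X = (P, Q, S)" by (cases X)
  note per = are_periodsD[OF per[unfolded st]]
  have pos: "0 < lcm P k" "0 < lcm Q l" and S: "(n mod P, m mod P, b mod Q) \<in> set S"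
    using surv per(1,2) by (auto simp: X survives_def intro: lcm_pos_nat)
  have fib: "lookup (fib_table k p) (i mod k) = fib i mod p" for i
    using fib_cong_mod_period[OF per(3,4), of i] per(1) by (simp add: lookup_fib_table cong_def)
  have geom: "lookup (geometric_table l p q c) (b mod l) = c * q ^ b mod p"
    using power_cong_mod_period[OF per(5), of b] per(2)
    by (simp add: lookup_geometric_table cong_def)
  have "lookup (fib_table k p) (n mod k) =
      (lookup (fib_table k p) (m mod k) + lookup (geometric_table l p q c) (b mod l)) mod p"
    by (simp add: fib geom eq mod_simps)
  then have "(n mod lcm P k, m mod lcm P k, b mod lcm Q l) \<in> set (solutions_mod p
      (lifts (fib_table k p) k P (lcm P k div P) (n mod P))
      (lifts (fib_table k p) k P (lcm P k div P) (m mod P))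
      (lifts (geometric_table l p q c) l Q (lcm Q l div Q) (b mod Q)))"
    by (intro solutions_modI[OF lifts_mod lifts_mod lifts_mod] pos) simp_all
  with S pos show ?thesis
    by (force simp: survives_def refine_classes_def X st)
qed

lemma survives_fold_sieve_step:
  assumes "fib n = fib m + c * q ^ b" "list_all (are_periods c q) sts" "survives n m b X"
  shows "survives n m b (fold (sieve_step c q) sts X)"
  using assms(2,3)
proof (induction sts arbitrary: X)
  case (Cons st sts)
  from Cons.prems have "are_periods c q st" "list_all (are_periods c q) sts" by simp_all
  with Cons.IH survives_sieve_step[OF assms(1)] Cons.prems(2) show ?case
    unfolding fold_Cons comp_apply by blast
qed simp

text \<open>A triple \<open>(p, k, l)\<close> consists of a modulus \<open>p\<close>, a period \<open>k\<close> of the Fibonacci sequence modulo \<open>p\<close>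
  and a period \<open>l\<close> of \<open>169 * 13 ^ b\<close> modulo \<open>p\<close>. The powers of 13 come first and last: modulo 13 the
  solutions with \<open>a = 0\<close> disappear, and the classes of the solutions with \<open>a = 1\<close> survive every other
  modulus and disappear only modulo 169.\<close>
definition moduli :: "(nat \<times> nat \<times> nat) list" where
  "moduli = [(13, 28, 1), (29, 14, 14), (71, 70, 70), (911, 70, 455), (131, 130, 65), (169, 364, 1)]"

lemma are_periods_moduli: "list_all (are_periods 169 13) moduli"
  by code_simp

lemma sieve_moduli_empty: "snd (snd (fold (sieve_step 169 13) moduli (1, 1, [(0, 0, 0)]))) = []"
  by code_simp

lemma fib_neq_fib_add_169_power: "fib n \<noteq> fib m + 169 * 13 ^ b"
proof
  assume "fib n = fib m + 169 * 13 ^ b"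
  moreover have "survives n m b (1, 1, [(0, 0, 0)])" by (simp add: survives_def)
  ultimately have "survives n m b (fold (sieve_step 169 13) moduli (1, 1, [(0, 0, 0)]))"
    using are_periods_moduli by (intro survives_fold_sieve_step)
  then show False
    using sieve_moduli_empty by (auto simp: survives_def split: prod.splits)
qed

text \<open>Since m is at most n - 1, the recurrence and monotonicity suffice.\<close>

lemma fib_add_le:
  assumes "m < n" "2 \<le> n"
  shows "fib m + fib (n - 2) \<le> fib n"
proof -
  obtain k where n: "n = Suc (Suc k)" using assms(2) by (metis add_2_eq_Suc le_Suc_ex)
  have "fib m \<le> fib (Suc k)" using assms(1) n by (intro fib_mono) simp
  then show ?thesis by (simp add: n)
qed

lemma fib_below_10:
  "fib 2 = 1" "fib 3 = 2" "fib 4 = 3" "fib 5 = 5" "fib 6 = 8" "fib 7 = 13" "fib 8 = 21" "fib 9 = 34"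
  by (simp_all add: numeral_eq_Suc)

theorem theorem1p2:
  shows "{(n :: nat, m :: nat, a :: nat).
            n \<ge> 2 \<and> m < n \<and> int (fib n) - int (fib m) = 13 ^ a} =
         {(2, 0, 0), (3, 1, 0), (3, 2, 0), (4, 3, 0), (7, 0, 1), (8, 6, 1), (9, 8, 1)}"
    (is "?L = ?R")
proof
  show "?R \<subseteq> ?L" by (auto simp: fib_below_10)
next
  have "(n, m, a) \<in> ?R"
    if n: "2 \<le> n" "m < n" and diff: "int (fib n) - int (fib m) = 13 ^ a" for n m a
  proof -
    have eq: "fib n = fib m + 13 ^ a"
      using diff by (simp add: diff_eq_eq flip: of_nat_eq_iff[where ?'a = int])
    have a: "a < 2"
    proof (rule ccontr)
      assume "\<not> a < 2"
      then obtain b where "a = 2 + b" using le_Suc_ex not_less by blast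
      with eq fib_neq_fib_add_169_power[of n m b] show False by (simp add: power_add)
    qed
    then have "(13 :: nat) ^ a \<le> 13" by (auto simp: less_2_cases_iff)
    with eq fib_add_le[OF n(2,1)] have small: "fib (n - 2) \<le> 13" by simp
    have "n < 10"
    proof (rule ccontr)
      assume "\<not> n < 10"
      \<comment> \<open>Here n - 2 is at least 8, and F_8 = 21 exceeds 13.\<close>
      then have "fib 8 \<le> fib (n - 2)" by (intro fib_mono) simp
      with small show False by (simp add: fib_below_10)
    qed
    \<comment> \<open>Explicit lists leave at most 8 * 9 * 2 cases for evaluation.\<close>
    with n have "n \<in> set [2..<10]" "m \<in> set [0..<9]" by auto
    moreover from a have "a = 0 \<or> a = 1" by auto
    ultimately show ?thesis
      using n eq by (simp add: upt_rec) (elim disjE; simp add: fib_below_10)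
  qed
  then show "?L \<subseteq> ?R"
    by (intro subsetI) (simp only: split_paired_all mem_Collect_eq prod.case)
qed

end
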